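(* Let $f:\mathbb{R}^n\to\mathbb{R}\cup\{+\infty\}$ be proper, lower semicontinuous and convex, $A\in\mathbb{R}^{m\times n}$, $b\in\mathbb{R}^m$. The set of minimizers over $x\in\mathbb{R}^n$ of $f(x)+\frac12\|Ax-b\|^2$ is nonempty if and only if both of the following hold: (i) $b\in\operatorname{ran}\big(I_m+\partial(A\triangleright f)\big)$; (ii) $A\triangleright f$ is exact at $J_{\partial(A\triangleright f)}(b)$.
   Context: The infimal postcomposition of $f$ by $A$ is the (convex, possibly improper or non-closed) function $A\triangleright f:\mathbb{R}^m\to[-\infty,+\infty]$, $(A\triangleright f)(t)=\inf\{f(x):x\in\mathbb{R}^n,\ Ax=t\}$. It is exact at $t$ if this infimum is attained, i.e. there is $x$ with $Ax=t$ and $f(x)=(A\triangleright f)(t)$. For $h:\mathbb{R}^m\to[-\infty,+\infty]$, $\partial h(t)=\{u:h(s)\ge h(t)+\langle u,s-t\rangle\ \forall s\}$ if $h(t)\in\mathbb{R}$, and $\partial h(t)=\varnothing$ otherwise. $J_{\mathcal B}=(I_m+\mathcal B)^{-1}$ is the resolvent; since $\partial(A\triangleright f)$ is monotone, $J_{\partial(A\triangleright f)}(b)$ is a single point whenever (i) holds. *)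

theory Defs
  imports "HOL-Analysis.Analysis"
begin

subsection \<open>Extended-real-valued convex functions\<close>

definition proper_fun :: "('a \<Rightarrow> ereal) \<Rightarrow> bool" where
  "proper_fun f \<longleftrightarrow> (\<forall>x. f x \<noteq> -\<infinity>) \<and> (\<exists>x. f x \<noteq> \<infinity>)"

definition lsc_fun :: "('a::topological_space \<Rightarrow> ereal) \<Rightarrow> bool" where
  "lsc_fun f \<longleftrightarrow> (\<forall>x. f x \<le> Liminf (at x) f)"

text \<open>Convexity is expressed through the epigraph, so that it makes sense for
  functions taking the value \<open>-\<infinity>\<close> as well.\<close>

definition epigraph :: "('a \<Rightarrow> ereal) \<Rightarrow> ('a \<times> real) set" where
  "epigraph f = {(x, r). f x \<le> ereal r}"

definition convex_fun :: "('a::real_vector \<Rightarrow> ereal) \<Rightarrow> bool" where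
  "convex_fun f \<longleftrightarrow> convex (epigraph f)"

definition minimizers :: "('a \<Rightarrow> ereal) \<Rightarrow> 'a set" where
  "minimizers g = {x. \<forall>y. g x \<le> g y}"

definition subdifferential :: "('a::real_inner \<Rightarrow> ereal) \<Rightarrow> 'a \<Rightarrow> 'a set" where
  "subdifferential h t =
     (if \<bar>h t\<bar> \<noteq> \<infinity> then {u. \<forall>s. h s \<ge> h t + ereal (u \<bullet> (s - t))} else {})"

subsection \<open>Infimal postcomposition\<close>

text \<open>The infimum over an empty fibre is \<open>\<infinity>\<close>.\<close>

definition inf_postcomp ::
    "real^'n^'m \<Rightarrow> (real^'n \<Rightarrow> ereal) \<Rightarrow> real^'m \<Rightarrow> ereal"  (infixr "\<triangleright>" 70) where
  "(A \<triangleright> f) t = (INF x\<in>{x. A *v x = t}. f x)"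

definition inf_postcomp_exact_at ::
    "real^'n^'m \<Rightarrow> (real^'n \<Rightarrow> ereal) \<Rightarrow> real^'m \<Rightarrow> bool" where
  "inf_postcomp_exact_at A f t \<longleftrightarrow> (\<exists>x. A *v x = t \<and> f x = (A \<triangleright> f) t)"

subsection \<open>Set-valued operators\<close>

definition op_ran :: "('a \<Rightarrow> 'b set) \<Rightarrow> 'b set" where
  "op_ran B = (\<Union>x. B x)"

definition op_inverse :: "('a \<Rightarrow> 'b set) \<Rightarrow> 'b \<Rightarrow> 'a set" where
  "op_inverse B y = {x. y \<in> B x}"

definition id_plus :: "('a::plus \<Rightarrow> 'a set) \<Rightarrow> 'a \<Rightarrow> 'a set" where
  "id_plus B x = {x + u |u. u \<in> B x}"

definition resolvent :: "('a::plus \<Rightarrow> 'a set) \<Rightarrow> 'a \<Rightarrow> 'a set" where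
  "resolvent B = op_inverse (id_plus B)"

text \<open>The resolvent is set-valued, as the inverse of a set-valued operator.  For a
  subdifferential it is a singleton at every point of the range, so \<open>the_elem\<close>
  selects its value there.\<close>

lemma resolvent_subdifferential_singleton:
  fixes h :: "'a::real_inner \<Rightarrow> ereal"
  assumes "b \<in> op_ran (id_plus (subdifferential h))"
  shows "resolvent (subdifferential h) b
           = {the_elem (resolvent (subdifferential h) b)}"
proof -
  have uniq: "s = t"
    if s: "s \<in> resolvent (subdifferential h) b"
      and t: "t \<in> resolvent (subdifferential h) b" for s t
  proof -
    have fs: "\<bar>h s\<bar> \<noteq> \<infinity>" and ft: "\<bar>h t\<bar> \<noteq> \<infinity>"
      and 1: "h t \<ge> h s + ereal ((b - s) \<bullet> (t - s))"
      and 2: "h s \<ge> h t + ereal ((b - t) \<bullet> (s - t))"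
      using s t
      by (auto simp: resolvent_def op_inverse_def id_plus_def subdifferential_def
               split: if_splits)
    obtain p q where "h s = ereal p" "h t = ereal q"
      using fs ft by (cases "h s"; cases "h t") auto
    then have "(b - s) \<bullet> (t - s) + (b - t) \<bullet> (s - t) \<le> 0"
      using 1 2 by simp
    moreover have "(b - s) \<bullet> (t - s) + (b - t) \<bullet> (s - t) = (t - s) \<bullet> (t - s)"
      by (simp add: inner_diff_left inner_diff_right inner_commute)
    ultimately have "(t - s) \<bullet> (t - s) = 0"
      using inner_ge_zero[of "t - s"] by linarith
    then show ?thesis
      by simp
  qed
  obtain t where "t \<in> resolvent (subdifferential h) b"
    using assms by (auto simp: op_ran_def resolvent_def op_inverse_def)
  then have "resolvent (subdifferential h) b = {t}"
    using uniq by auto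
  then show ?thesis
    by simp
qed

end

theory Submission
  imports Defs
begin

text \<open>Write \<open>h = A \<triangleright> f\<close>.  Both sides of the equivalence describe one variational
  inequality.  By convexity, a point \<open>x\<close> at which \<open>f\<close> is finite minimizes
  \<open>f + 1/2 \<parallel>A \<cdot> - b\<parallel>\<^sup>2\<close> exactly when
  \<open>f y \<ge> f x + \<langle>b - A x, A y - A x\<rangle>\<close> for all \<open>y\<close>: the quadratic may be replaced by its
  linearization at \<open>x\<close> (lemma \<open>least_squares_minimizer_iff\<close>).  The lower bound depends on
  \<open>y\<close> only through \<open>A y\<close>, so taking infima over the fibres of \<open>A\<close> turns the inequality
  into \<open>h s \<ge> f x + \<langle>b - t, s - t\<rangle>\<close> for all \<open>s\<close>, where \<open>t = A x\<close>.  At \<open>s = t\<close> it forces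
  \<open>f x = h t\<close>, which is exactness at \<open>t\<close>; the rest is \<open>b - t \<in> \<partial>h(t)\<close>
  (lemma \<open>subgradient_and_exact_iff\<close>), that is, \<open>t\<close> is the resolvent point of \<open>b\<close>.\<close>

lemma half_square_norm_expansion:
  fixes b t v :: "'a::real_inner"
  shows "1/2 * (norm (v - b))\<^sup>2
    = 1/2 * (norm (t - b))\<^sup>2 - (b - t) \<bullet> (v - t) + 1/2 * (norm (v - t))\<^sup>2"
  by (simp add: power2_norm_eq_inner inner_diff_left inner_diff_right inner_commute algebra_simps)

lemma convex_fun_le:
  fixes f :: "'a::real_vector \<Rightarrow> ereal"
  assumes "convex_fun f" and "f x \<le> ereal p" and "f y \<le> ereal r"
    and "0 \<le> l" and "l \<le> 1"
  shows "f ((1 - l) *\<^sub>R x + l *\<^sub>R y) \<le> ereal ((1 - l) * p + l * r)"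
proof -
  have "(1 - l) *\<^sub>R (x, p) + l *\<^sub>R (y, r) \<in> epigraph f"
    using assms convexD_alt[of "epigraph f" "(x, p)" "(y, r)" l]
    by (simp add: convex_fun_def epigraph_def)
  then show ?thesis
    by (simp add: epigraph_def)
qed

text \<open>If \<open>l \<cdot> c \<le> l\<^sup>2 \<cdot> d\<close> for all small \<open>l > 0\<close>, then division by \<open>l\<close> and \<open>l \<rightarrow> 0\<close>
  give \<open>c \<le> 0\<close>.\<close>

lemma nonpos_if_dominated_by_square:
  fixes c d :: real
  assumes "\<And>l. 0 < l \<Longrightarrow> l \<le> 1 \<Longrightarrow> l * c \<le> l\<^sup>2 * d"
  shows "c \<le> 0"
proof (rule tendsto_lowerbound)
  show "((\<lambda>l. l * d) \<longlongrightarrow> 0) (at_right 0)"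
    by (auto intro!: tendsto_eq_intros)
  have "c \<le> l * d" if "l \<in> {0<..<1}" for l
    using assms[of l] that by (simp add: power2_eq_square)
  then show "\<forall>\<^sub>F l in at_right 0. c \<le> l * d"
    using eventually_at_right_real[of 0 1] by (auto elim: eventually_mono)
qed simp

text \<open>The linear inequality implies minimality because the second-order remainder of the
  quadratic is nonnegative.  Conversely, along the segment from \<open>x\<close> to \<open>y\<close> that remainder is
  of second order in the step length, whereas convexity bounds the increase of \<open>f\<close> to first
  order, so the remainder drops out as the step length tends to zero.\<close>

lemma least_squares_minimizer_iff:
  fixes f :: "'a::real_vector \<Rightarrow> ereal" and T :: "'a \<Rightarrow> 'b::real_inner"
  assumes T: "linear T" and f: "convex_fun f" and fx: "f x = ereal p"
  shows "x \<in> minimizers (\<lambda>x. f x + ereal (1/2 * (norm (T x - b))\<^sup>2))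
    \<longleftrightarrow> (\<forall>y. f x + ereal ((b - T x) \<bullet> (T y - T x)) \<le> f y)"
    (is "?min \<longleftrightarrow> (\<forall>y. ?ineq y)")
proof
  assume min: ?min
  then have le: "ereal p + ereal (1/2 * (norm (T x - b))\<^sup>2)
      \<le> f y + ereal (1/2 * (norm (T y - b))\<^sup>2)" for y
    using fx unfolding minimizers_def mem_Collect_eq by metis
  show "\<forall>y. ?ineq y"
  proof
    fix y
    show "?ineq y"
    proof (cases "f y")
      case (real r)
      define d where "d = T y - T x"
      have "(b - T x) \<bullet> d - (r - p) \<le> 0"
      proof (rule nonpos_if_dominated_by_square)
        fix l :: real
        assume l: "0 < l" "l \<le> 1"
        define z where "z = (1 - l) *\<^sub>R x + l *\<^sub>R y"
        have Tz: "T z - T x = l *\<^sub>R d"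
          by (simp add: z_def d_def linear_add[OF T] linear_scale[OF T] linear_diff[OF T]
              algebra_simps)
        have fz: "f z \<le> ereal ((1 - l) * p + l * r)"
          unfolding z_def using f fx real l by (intro convex_fun_le) auto
        have "ereal p + ereal (1/2 * (norm (T x - b))\<^sup>2)
            \<le> ereal ((1 - l) * p + l * r) + ereal (1/2 * (norm (T z - b))\<^sup>2)"
          using le[of z] add_right_mono[OF fz] by (rule order_trans)
        then have "p + 1/2 * (norm (T x - b))\<^sup>2
            \<le> (1 - l) * p + l * r + 1/2 * (norm (T z - b))\<^sup>2"
          by simp
        then show "l * ((b - T x) \<bullet> d - (r - p)) \<le> l\<^sup>2 * (1/2 * (norm d)\<^sup>2)"
          unfolding half_square_norm_expansion[of "T z" b "T x"] Tz
          by (simp add: power_mult_distrib algebra_simps)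
      qed
      then show ?thesis
        using fx real by (simp add: d_def)
    next
      case MInf
      then show ?thesis
        using le[of y] by simp
    qed simp
  qed
next
  assume ineq: "\<forall>y. ?ineq y"
  have "ereal (p + 1/2 * (norm (T x - b))\<^sup>2) \<le> f y + ereal (1/2 * (norm (T y - b))\<^sup>2)" for y
  proof (cases "f y")
    case (real r)
    then have "p + (b - T x) \<bullet> (T y - T x) \<le> r"
      using ineq[rule_format, of y] fx by simp
    then have "p + 1/2 * (norm (T x - b))\<^sup>2 \<le> r + 1/2 * (norm (T y - b))\<^sup>2"
      unfolding half_square_norm_expansion[of "T y" b "T x"]
      using zero_le_power2[of "norm (T y - T x)"] by linarith
    then show ?thesis
      using real by simp
  next
    case MInf
    then show ?thesis
      using ineq[rule_format, of y] fx by simp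
  qed simp
  then show ?min
    by (simp add: minimizers_def fx)
qed

lemma inf_postcomp_le: "(A \<triangleright> f) (A *v x) \<le> f x"
  unfolding inf_postcomp_def by (rule INF_lower) simp

lemma le_inf_postcomp: "(\<And>x. A *v x = t \<Longrightarrow> c \<le> f x) \<Longrightarrow> c \<le> (A \<triangleright> f) t"
  unfolding inf_postcomp_def by (rule INF_greatest) simp

text \<open>An affine minorant of \<open>y \<mapsto> f y\<close> that depends on \<open>y\<close> only through \<open>A y\<close> is the same as
  an affine minorant of \<open>A \<triangleright> f\<close>; if the first touches \<open>f\<close> at \<open>x\<close>, the second touches
  \<open>A \<triangleright> f\<close> at \<open>A x\<close> with the same value, and this is exactness.\<close>

lemma subgradient_and_exact_iff:
  "u \<in> subdifferential (A \<triangleright> f) t \<and> inf_postcomp_exact_at A f t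
    \<longleftrightarrow> (\<exists>x. A *v x = t \<and> \<bar>f x\<bar> \<noteq> \<infinity> \<and> (\<forall>y. f x + ereal (u \<bullet> (A *v y - t)) \<le> f y))"
    (is "?L \<longleftrightarrow> ?R")
proof
  assume ?L
  then have u: "u \<in> subdifferential (A \<triangleright> f) t" and "inf_postcomp_exact_at A f t"
    by auto
  then obtain x where x: "A *v x = t" "f x = (A \<triangleright> f) t"
    by (auto simp: inf_postcomp_exact_at_def)
  have fin: "\<bar>f x\<bar> \<noteq> \<infinity>" and ineq: "f x + ereal (u \<bullet> (s - t)) \<le> (A \<triangleright> f) s" for s
    using u x by (auto simp: subdifferential_def split: if_splits)
  have "f x + ereal (u \<bullet> (A *v y - t)) \<le> f y" for y
    using ineq inf_postcomp_le by (rule order_trans)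
  then show ?R
    using x(1) fin by (intro exI[of _ x] conjI allI)
next
  assume ?R
  then obtain x where x: "A *v x = t" and fin: "\<bar>f x\<bar> \<noteq> \<infinity>"
    and ineq: "\<And>y. f x + ereal (u \<bullet> (A *v y - t)) \<le> f y"
    by auto
  have le: "f x + ereal (u \<bullet> (s - t)) \<le> (A \<triangleright> f) s" for s
    using ineq by (intro le_inf_postcomp) auto
  have "(A \<triangleright> f) t \<le> f x"
    using inf_postcomp_le[of A f x] x by simp
  then have eq: "(A \<triangleright> f) t = f x"
    using le[of t] by (intro antisym) (simp_all flip: zero_ereal_def)
  have "u \<in> subdifferential (A \<triangleright> f) t"
    using fin le by (simp add: subdifferential_def eq)
  moreover have "inf_postcomp_exact_at A f t"
    using x eq by (auto simp: inf_postcomp_exact_at_def)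
  ultimately show ?L ..
qed

lemma mem_resolvent_iff:
  fixes B :: "'a::ab_group_add \<Rightarrow> 'a set"
  shows "t \<in> resolvent B b \<longleftrightarrow> b - t \<in> B t"
  by (force simp: resolvent_def op_inverse_def id_plus_def)

text \<open>The uniqueness of the resolvent point allows the choice \<open>the_elem\<close> to be replaced by
  an existential quantifier.\<close>

lemma range_and_resolvent_iff:
  fixes h :: "'a::real_inner \<Rightarrow> ereal"
  shows "b \<in> op_ran (id_plus (subdifferential h))
      \<and> P (the_elem (resolvent (subdifferential h) b))
    \<longleftrightarrow> (\<exists>t. b - t \<in> subdifferential h t \<and> P t)"
proof -
  let ?R = "resolvent (subdifferential h) b"
  have ran: "b \<in> op_ran (id_plus (subdifferential h)) \<longleftrightarrow> (\<exists>t. t \<in> ?R)"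
    by (auto simp: op_ran_def resolvent_def op_inverse_def)
  have "t = the_elem ?R" if "t \<in> ?R" for t
    using that ran resolvent_subdifferential_singleton[of b h] by blast
  then show ?thesis
    unfolding ran mem_resolvent_iff[symmetric] by metis
qed

lemma minimizers_finite:
  assumes "proper_fun f" and "x \<in> minimizers (\<lambda>x. f x + ereal (q x))"
  shows "\<bar>f x\<bar> \<noteq> \<infinity>"
proof -
  obtain y where "f y \<noteq> \<infinity>"
    using assms(1) by (auto simp: proper_fun_def)
  moreover have "f x + ereal (q x) \<le> f y + ereal (q y)"
    using assms(2) by (simp add: minimizers_def)
  ultimately have "f x \<noteq> \<infinity>"
    by auto
  then show ?thesis
    using assms(1) by (auto simp: proper_fun_def)
qed

theorem proposition3p11:
  fixes f :: "real^'n \<Rightarrow> ereal"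
    and A :: "real^'n^'m"
    and b :: "real^'m"
  assumes "proper_fun f" and "lsc_fun f" and "convex_fun f"
  shows "minimizers (\<lambda>x. f x + ereal (1/2 * (norm (A *v x - b))^2)) \<noteq> {}
     \<longleftrightarrow> b \<in> op_ran (id_plus (subdifferential (A \<triangleright> f)))
       \<and> inf_postcomp_exact_at A f
             (the_elem (resolvent (subdifferential (A \<triangleright> f)) b))"
proof -
  let ?M = "minimizers (\<lambda>x. f x + ereal (1/2 * (norm (A *v x - b))^2))"
  let ?V = "\<lambda>x. \<forall>y. f x + ereal ((b - A *v x) \<bullet> (A *v y - A *v x)) \<le> f y"
  have iff: "x \<in> ?M \<longleftrightarrow> ?V x" if "\<bar>f x\<bar> \<noteq> \<infinity>" for x
    using that least_squares_minimizer_iff[OF matrix_vector_mul_linear assms(3), of x _ A b]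
    by (cases "f x") auto
  have fin: "\<bar>f x\<bar> \<noteq> \<infinity>" if "x \<in> ?M" for x
    using minimizers_finite[OF assms(1) that] .
  have "x \<in> ?M \<longleftrightarrow> \<bar>f x\<bar> \<noteq> \<infinity> \<and> ?V x" for x
    using iff[of x] fin[of x] by argo
  then have "?M \<noteq> {} \<longleftrightarrow> (\<exists>x. \<bar>f x\<bar> \<noteq> \<infinity> \<and> ?V x)"
    unfolding ex_in_conv[symmetric] by (rule ex_cong1)
  also have "\<dots> \<longleftrightarrow> (\<exists>t. b - t \<in> subdifferential (A \<triangleright> f) t \<and> inf_postcomp_exact_at A f t)"
    unfolding subgradient_and_exact_iff by simp
  finally show ?thesis
    unfolding range_and_resolvent_iff .
qed

end
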